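(* Let $K$ be an algebraically closed field and let $P(x)=\sum_{i=0}^n x^iP_i$ be a regular $m\times m$ matrix polynomial of degree $n$ over $K$. Let $b_1(x),\ldots,b_q(x)\in K[x]$ be pairwise co-prime monic polynomials with $\deg b_i(x)=d_i\geq 1$ and $\sum_{i=1}^q d_i=n$, and let $s\in K$ be such that $\lambda b_q(\xi)+s\ne 0$ for any eigenvalue $\lambda$ of $P_n$ and any root $\xi$ of $b_i(x)$, $i=1,\ldots,q-1$. Put $B_i(x)=b_i(x)I_m$ for $i=1,\ldots,q-1$, $B_q(x)=b_q(x)P_n+sI_m$, $C_i(x)=\prod_{j\ne i}B_j(x)$, and let $W_1(x),\ldots,W_q(x)$ be the unique $m\times m$ matrix polynomials with $\deg W_i(x)<d_i$ such that $$P(x)=\prod_{i=1}^q B_i(x)+\sum_{i=1}^q W_i(x)C_i(x).$$ If $b_i(x)=x-\beta_i$, $i=1,\ldots,q$, then $q=n$ and the $W_i$ are the constant matrices $$W_i=\frac{P(\beta_i)}{\prod_{j=1,\,j\ne i}^{n-1}(\beta_i-\beta_j)}\big((\beta_i-\beta_n)P_n+sI_m\big)^{-1},\quad i=1,\ldots,n-1,$$ $$W_n=\frac{P(\beta_n)}{\prod_{j=1}^{n-1}(\beta_n-\beta_j)}-sI_m-s\sum_{j=1}^{n-1}\frac{W_j}{\beta_n-\beta_j}.$$ Moreover, if $P(x)$ is monic (that is, $P_n=I_m$), then with $s=0$ the expression for $W_i$ turns into $W_i=P(\beta_i)/\prod_{j=1,\,j\ne i}^n(\beta_i-\beta_j)$,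 for $i=1,\ldots,n$.
   Context: A matrix polynomial is regular if its determinant is not identically zero, and $P$ has degree $n$ if $P_n\ne 0$. The zero polynomial is regarded as having degree smaller than any nonnegative integer. Under the stated hypotheses on $b_i$ and $s$, matrix polynomials $W_i(x)$ with $\deg W_i<d_i$ realizing the displayed decomposition of $P(x)$ exist and are unique. *)

theory Defs
  imports
    "HOL-Analysis.Analysis"
    "HOL-Computational_Algebra.Computational_Algebra"
begin

(* An m x m matrix polynomial over K is a matrix with entries in K[x], where the finite index
   type 'm has m elements.  On this type the class operation * is entrywise; the matrix product
   is **. *)

type_synonym ('a, 'm) mat_poly = "(('a poly, 'm) vec, 'm) vec"

definition mp_coeff :: "('a::zero, 'm::finite) mat_poly \<Rightarrow> nat \<Rightarrow> 'a^'m^'m" where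
  "mp_coeff P k = map_matrix (\<lambda>p. coeff p k) P"

definition mp_eval :: "('a::comm_semiring_0, 'm::finite) mat_poly \<Rightarrow> 'a \<Rightarrow> 'a^'m^'m" where
  "mp_eval P x = map_matrix (\<lambda>p. poly p x) P"

definition mp_const :: "'a::zero^'m^'m \<Rightarrow> ('a, 'm::finite) mat_poly" where
  "mp_const A = map_matrix (\<lambda>c. [:c:]) A"

definition mp_has_degree :: "('a::zero, 'm::finite) mat_poly \<Rightarrow> nat \<Rightarrow> bool" where
  "mp_has_degree P n \<longleftrightarrow> mp_coeff P n \<noteq> 0 \<and> (\<forall>k>n. mp_coeff P k = 0)"

(* The zero matrix polynomial has degree smaller than every d. *)
definition mp_degree_less :: "('a::zero, 'm::finite) mat_poly \<Rightarrow> nat \<Rightarrow> bool" where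
  "mp_degree_less W d \<longleftrightarrow> (\<forall>k\<ge>d. mp_coeff W k = 0)"

definition mp_regular :: "('a::comm_ring_1, 'm::finite) mat_poly \<Rightarrow> bool" where
  "mp_regular P \<longleftrightarrow> det P \<noteq> 0"

definition mat_eigenvalue :: "'a::field^'m^'m \<Rightarrow> 'a \<Rightarrow> bool" where
  "mat_eigenvalue A l \<longleftrightarrow> (\<exists>v. v \<noteq> 0 \<and> A *v v = l *s v)"

definition mat_scale :: "'a::times \<Rightarrow> 'a^'m^'m \<Rightarrow> 'a^'m^'m" (infixr \<open>*m\<close> 75) where
  "c *m A = map_matrix (\<lambda>a. c * a) A"

(* Ordered product; the factors to which it is applied below commute. *)
definition mat_prod_list :: "('a::semiring_1^'m^'m) list \<Rightarrow> 'a^'m^'m" where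
  "mat_prod_list As = foldr (**) As (mat 1)"

(* B_i = b_i I for i < q and B_q = b_q P_n + s I, where A plays the role of P_n. *)
definition B_mp :: "nat \<Rightarrow> (nat \<Rightarrow> 'a::comm_ring_1 poly) \<Rightarrow> 'a^'m^'m \<Rightarrow> 'a \<Rightarrow> nat \<Rightarrow> ('a, 'm::finite) mat_poly" where
  "B_mp q b A s i = (if i = q then b q *m mp_const A + mat [:s:] else mat (b i))"

definition C_mp :: "nat \<Rightarrow> (nat \<Rightarrow> 'a::comm_ring_1 poly) \<Rightarrow> 'a^'m^'m \<Rightarrow> 'a \<Rightarrow> nat \<Rightarrow> ('a, 'm::finite) mat_poly" where
  "C_mp q b A s i = mat_prod_list (map (B_mp q b A s) (filter (\<lambda>j. j \<noteq> i) [1..<Suc q]))"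

(* W_1, ..., W_q realize the decomposition of P; values of W outside {1..q} are irrelevant. *)
definition mp_decomposition ::
  "('a::comm_ring_1, 'm::finite) mat_poly \<Rightarrow> nat \<Rightarrow> nat \<Rightarrow> (nat \<Rightarrow> 'a poly) \<Rightarrow> 'a
     \<Rightarrow> (nat \<Rightarrow> ('a, 'm) mat_poly) \<Rightarrow> bool" where
  "mp_decomposition P n q b s W \<longleftrightarrow>
     (\<forall>i\<in>{1..q}. mp_degree_less (W i) (degree (b i))) \<and>
     P = mat_prod_list (map (B_mp q b (mp_coeff P n) s) [1..<Suc q])
         + (\<Sum>i\<in>{1..q}. W i ** C_mp q b (mp_coeff P n) s i)"

end

theory Submission
  imports Defs
begin

text \<open>The statement is Lagrange interpolation for matrix polynomials. The product of the \<open>B\<^sub>i\<close> has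
  the same coefficient of \<open>x\<^sup>n\<close> as \<open>P\<close>, and every \<open>C\<^sub>i\<close> has degree less than \<open>n\<close>. Hence, for constant
  \<open>W\<^sub>i\<close>, the two sides of the decomposition differ by a matrix polynomial of degree less than \<open>n\<close>,
  and they are equal as soon as they agree at the \<open>n\<close> nodes \<open>\<beta>\<^sub>1, \<dots>, \<beta>\<^sub>n\<close>, which are distinct because
  the \<open>b\<^sub>i\<close> are coprime. So the decomposition is equivalent to \<open>n\<close> equations between constant
  matrices (lemma \<open>mp_decomposition_const_iff_nodes\<close>).

  These equations form a triangular system. At \<open>\<beta>\<^sub>i\<close> with \<open>i < n\<close> the scalar factor \<open>b\<^sub>i\<close> vanishes, and it
  occurs in the full product and in every \<open>C\<^sub>j\<close> except \<open>C\<^sub>i\<close>; the equation there involves \<open>W\<^sub>i\<close> alone,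
  multiplied by a nonzero scalar and by \<open>B\<^sub>n(\<beta>\<^sub>i) = (\<beta>\<^sub>i - \<beta>\<^sub>n) P\<^sub>n + s I\<close>. The condition on \<open>s\<close> says that
  this matrix is invertible (lemma \<open>invertible_scale_add_mat\<close>), so \<open>W\<^sub>i\<close> is determined
  (lemma \<open>eq_scaled_mult_iff\<close>). At \<open>\<beta>\<^sub>n\<close> the last factor \<open>B\<^sub>n\<close> reduces to \<open>s I\<close>, and the
  equation gives \<open>W\<^sub>n\<close>, whose coefficient \<open>C\<^sub>n(\<beta>\<^sub>n)\<close> is a nonzero scalar, in terms of the other \<open>W\<^sub>j\<close>
  (lemma \<open>last_node_equation_iff\<close>). Since each step is an equivalence, existence, uniqueness
  and the formulas come out together. If \<open>P\<close> is monic and \<open>s = 0\<close>, then \<open>B\<^sub>n(\<beta>\<^sub>i)\<close> is the scalar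
  \<open>\<beta>\<^sub>i - \<beta>\<^sub>n\<close>, and the formulas become those of Lagrange.\<close>

section \<open>Matrix polynomials\<close>

lemma mat_scale_nth [simp]: "(c *m A) $ i $ j = c * A $ i $ j"
  by (simp add: mat_scale_def)

lemma mp_eval_nth [simp]: "mp_eval P x $ i $ j = poly (P $ i $ j) x"
  by (simp add: mp_eval_def)

lemma mp_coeff_nth [simp]: "mp_coeff P k $ i $ j = coeff (P $ i $ j) k"
  by (simp add: mp_coeff_def)

lemma mp_const_nth [simp]: "mp_const A $ i $ j = [:A $ i $ j:]"
  by (simp add: mp_const_def)

lemma mat_nth: "mat c $ i $ j = (if i = j then c else 0)"
  by (simp add: mat_def)

lemma matrix_mult_nth: "(A ** B) $ i $ j = (\<Sum>k\<in>UNIV. A $ i $ k * B $ k $ j)"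
  by (simp add: matrix_matrix_mult_def)

lemma mat_matrix_mult: "mat c ** A = c *m A"
  by (simp add: vec_eq_iff matrix_mult_nth mat_nth if_distrib if_distribR sum.delta' cong: if_cong)

lemma matrix_mult_mat:
  fixes A :: "'a::comm_semiring_1^'m::finite^'m"
  shows "A ** mat c = c *m A"
  by (simp add: vec_eq_iff matrix_mult_nth mat_nth if_distrib sum.delta mult.commute cong: if_cong)

lemma matrix_mult_scale:
  fixes A :: "'a::comm_semiring_1^'m::finite^'m"
  shows "A ** (c *m B) = c *m (A ** B)"
  by (simp add: vec_eq_iff matrix_mult_nth sum_distrib_left mult_ac)

lemma scale_scale:
  fixes A :: "'a::semigroup_mult^'m::finite^'m"
  shows "c *m (d *m A) = (c * d) *m A"
  by (simp add: vec_eq_iff mult.assoc)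

lemma scale_one [simp]:
  fixes A :: "'a::monoid_mult^'m::finite^'m"
  shows "1 *m A = A"
  by (simp add: vec_eq_iff)

lemma scale_mat:
  fixes c d :: "'a::mult_zero"
  shows "c *m mat d = mat (c * d)"
  by (simp add: vec_eq_iff mat_nth)

lemma scale_add:
  fixes A :: "'a::semiring^'m::finite^'m"
  shows "c *m (A + B) = c *m A + c *m B"
  by (simp add: vec_eq_iff distrib_left)

lemma scale_sum:
  fixes A :: "'b \<Rightarrow> 'a::semiring_0^'m::finite^'m"
  shows "c *m (\<Sum>i\<in>I. A i) = (\<Sum>i\<in>I. c *m A i)"
  by (simp add: vec_eq_iff sum_distrib_left)

lemma mp_eval_add: "mp_eval (P + Q) x = mp_eval P x + mp_eval Q x"
  by (simp add: vec_eq_iff)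

lemma mp_eval_sum: "mp_eval (\<Sum>i\<in>I. P i) x = (\<Sum>i\<in>I. mp_eval (P i) x)"
  by (simp add: vec_eq_iff poly_sum)

lemma mp_eval_mult:
  fixes P Q :: "('a::comm_semiring_1, 'm::finite) mat_poly"
  shows "mp_eval (P ** Q) x = mp_eval P x ** mp_eval Q x"
  by (simp add: vec_eq_iff matrix_mult_nth poly_sum)

lemma mp_eval_scale: "mp_eval (p *m P) x = poly p x *m mp_eval P x"
  for p :: "'a::comm_semiring_1 poly"
  by (simp add: vec_eq_iff)

lemma mp_eval_mat: "mp_eval (mat p) x = mat (poly p x)"
  by (simp add: vec_eq_iff mat_nth)

lemma mp_eval_const: "mp_eval (mp_const A) x = A"
  by (simp add: vec_eq_iff)

lemmas mp_eval_simps = mp_eval_add mp_eval_sum mp_eval_mult mp_eval_scale mp_eval_mat mp_eval_const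

lemma mp_degree_less_add: "mp_degree_less P d \<Longrightarrow> mp_degree_less Q d \<Longrightarrow> mp_degree_less (P + Q) d"
  by (simp add: mp_degree_less_def vec_eq_iff)

lemma mp_degree_less_sum:
  "(\<And>i. i \<in> I \<Longrightarrow> mp_degree_less (P i) d) \<Longrightarrow> mp_degree_less (\<Sum>i\<in>I. P i) d"
  by (simp add: mp_degree_less_def vec_eq_iff coeff_sum)

lemma mp_degree_less_const_mult:
  fixes P :: "('a::comm_semiring_1, 'm::finite) mat_poly"
  shows "mp_degree_less P d \<Longrightarrow> mp_degree_less (mp_const V ** P) d"
  by (simp add: mp_degree_less_def vec_eq_iff matrix_mult_nth coeff_sum)

lemma mp_degree_less_one_imp_const: "mp_degree_less W 1 \<Longrightarrow> W = mp_const (mp_coeff W 0)"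
  by (auto simp: mp_degree_less_def vec_eq_iff poly_eq_iff coeff_pCons split: nat.split)

text \<open>Entry by entry, this is the fact that a polynomial of degree less than \<open>n\<close> has fewer than
  \<open>n\<close> roots.\<close>

lemma mp_eqI_nodes:
  fixes P Q :: "('a::idom, 'm::finite) mat_poly"
  assumes deg: "mp_degree_less (P - Q) n" and card: "card N = n" and pos: "0 < n"
    and eval: "\<And>x. x \<in> N \<Longrightarrow> mp_eval P x = mp_eval Q x"
  shows "P = Q"
proof -
  have "P $ i $ j - Q $ i $ j = 0" for i j
  proof (rule poly_eqI_degree)
    show "poly (P $ i $ j - Q $ i $ j) x = poly 0 x" if "x \<in> N" for x
      using eval[OF that] by (simp add: vec_eq_iff)
    have "coeff (P $ i $ j - Q $ i $ j) k = 0" if "k \<ge> n" for k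
      using deg that by (simp add: mp_degree_less_def vec_eq_iff)
    then show "degree (P $ i $ j - Q $ i $ j) < card N"
      using pos card by (metis leading_coeff_0_iff degree_0 not_le)
  qed (use card pos in auto)
  then show ?thesis by (simp add: vec_eq_iff)
qed

section \<open>The products of the basis polynomials\<close>

lemma mat_prod_list_append: "mat_prod_list (As @ Bs) = mat_prod_list As ** mat_prod_list Bs"
  by (induction As) (simp_all add: mat_prod_list_def matrix_mul_assoc)

text \<open>All factors but the last are scalar, so every product that occurs in the decomposition is
  a scalar polynomial, times the last factor if that factor takes part.\<close>

lemma mat_prod_list_B_mp:
  assumes "distinct L" "q \<notin> set L"
  shows "mat_prod_list (map (B_mp q b A s) L) = mat (\<Prod>j\<in>set L. b j)"
  using assms
proof (induction L)
  case (Cons j L)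
  have "mat_prod_list (map (B_mp q b A s) (j # L)) =
      mat (b j) ** mat_prod_list (map (B_mp q b A s) L)"
    using Cons.prems by (auto simp: mat_prod_list_def B_mp_def)
  then show ?case
    using Cons by (simp add: mat_matrix_mult scale_mat)
qed (simp add: mat_prod_list_def)

lemma mat_prod_list_B_mp_snoc:
  assumes "distinct L" "q \<notin> set L"
  shows "mat_prod_list (map (B_mp q b A s) (L @ [q])) =
    (\<Prod>j\<in>set L. b j) *m (b q *m mp_const A + mat [:s:])"
  unfolding map_append mat_prod_list_append mat_prod_list_B_mp[OF assms] mat_matrix_mult
  by (simp add: mat_prod_list_def B_mp_def)

lemma mat_prod_list_B_mp_all:
  assumes "1 \<le> q"
  shows "mat_prod_list (map (B_mp q b A s) [1..<Suc q]) =
    (\<Prod>j\<in>{1..q - 1}. b j) *m (b q *m mp_const A + mat [:s:])"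
proof -
  have list: "[1..<Suc q] = [1..<q] @ [q]" using assms by simp
  have set: "set [1..<q] = {1..q - 1}" using assms by auto
  have "q \<notin> set [1..<q]" by simp
  show ?thesis
    unfolding list mat_prod_list_B_mp_snoc[OF distinct_upt \<open>q \<notin> set [1..<q]\<close>] set ..
qed

lemma C_mp_last:
  assumes "1 \<le> q"
  shows "C_mp q b A s q = mat (\<Prod>j\<in>{1..q - 1}. b j)"
proof -
  have list: "filter (\<lambda>j. j \<noteq> q) [1..<Suc q] = [1..<q]"
    using assms by (simp add: filter_id_conv)
  have set: "set [1..<q] = {1..q - 1}" using assms by auto
  have "q \<notin> set [1..<q]" by simp
  show ?thesis
    unfolding C_mp_def list mat_prod_list_B_mp[OF distinct_upt \<open>q \<notin> set [1..<q]\<close>] set ..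
qed

lemma C_mp_before_last:
  assumes "i \<in> {1..q - 1}"
  shows "C_mp q b A s i = (\<Prod>j\<in>{1..q - 1} - {i}. b j) *m (b q *m mp_const A + mat [:s:])"
proof -
  let ?L = "filter (\<lambda>j. j \<noteq> i) [1..<q]"
  have list: "filter (\<lambda>j. j \<noteq> i) [1..<Suc q] = ?L @ [q]"
    using assms by auto
  have set: "set ?L = {1..q - 1} - {i}" by auto
  have L: "distinct ?L" "q \<notin> set ?L" by simp_all
  show ?thesis
    unfolding C_mp_def list mat_prod_list_B_mp_snoc[OF L] set ..
qed

text \<open>If \<open>g\<close> has degree less than \<open>n\<close>, the term with \<open>s\<close> does not reach \<open>x\<^sup>n\<close>. So the full product has
  the leading coefficient \<open>A\<close> whatever \<open>s\<close> is.\<close>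

lemma mp_coeff_scaled_last_factor:
  fixes A :: "'a::comm_ring_1^'m::finite^'m"
  shows "mp_coeff (g *m (p *m mp_const A + mat [:s:])) k =
    coeff (g * p) k *m A + mat (coeff g k * s)"
proof -
  have "coeff (g * (p * [:a:] + c)) k = coeff (g * p) k * a + coeff (g * c) k" for a and c
  proof -
    have "g * (p * [:a:] + c) = smult a (g * p) + g * c"
      by (simp add: distrib_left mult.commute[of _ "[:a:]"])
    then show ?thesis by (simp add: mult.commute)
  qed
  then show ?thesis
    by (simp add: vec_eq_iff mat_nth mult.commute)
qed

lemma mp_degree_less_mat: "degree p < d \<Longrightarrow> mp_degree_less (mat p) d"
  by (simp add: mp_degree_less_def vec_eq_iff mat_nth coeff_eq_0)

section \<open>The decomposition as an interpolation problem\<close>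

lemma degree_prod_monic_linear:
  "degree (\<Prod>j\<in>J. [:- \<beta> j, 1:]) = card J" for \<beta> :: "'b \<Rightarrow> 'a::idom"
  by (subst degree_prod_sum_eq) auto

text \<open>The difference of the two sides has degree less than \<open>n\<close>, so it is zero if and only if it
  vanishes at all nodes. At \<open>\<beta> i\<close> with \<open>i < n\<close> only the summand with index \<open>i\<close> survives; at \<open>\<beta> n\<close>
  the last factor becomes the scalar \<open>s\<close>, which then multiplies every term but \<open>V n\<close>.\<close>

lemma mp_decomposition_const_iff_nodes:
  fixes P :: "('a::idom, 'm::finite) mat_poly"
  assumes n: "1 \<le> n" and deg: "mp_has_degree P n"
    and b: "\<forall>i\<in>{1..n}. b i = [:- \<beta> i, 1:]" and inj: "inj_on \<beta> {1..n}"
  defines "A \<equiv> mp_coeff P n"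
  shows "mp_decomposition P n n b s (\<lambda>i. mp_const (V i)) \<longleftrightarrow>
    (\<forall>i\<in>{1..n - 1}. mp_eval P (\<beta> i) =
       (\<Prod>j\<in>{1..n - 1} - {i}. \<beta> i - \<beta> j) *m (V i ** ((\<beta> i - \<beta> n) *m A + mat s))) \<and>
    mp_eval P (\<beta> n) = (\<Prod>j\<in>{1..n - 1}. \<beta> n - \<beta> j) *m (mat s + V n) +
       (\<Sum>i\<in>{1..n - 1}. (s * (\<Prod>j\<in>{1..n - 1} - {i}. \<beta> n - \<beta> j)) *m V i)"
proof -
  \<comment> \<open>\<open>b\<close> is arbitrary outside \<open>{1..n}\<close>; \<open>lin\<close> is linear at every index.\<close>
  define lin where "lin j = [:- \<beta> j, 1:]" for j
  define M where "M = lin n *m mp_const A + mat [:s:]"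
  define F where "F = (\<Prod>j\<in>{1..n - 1}. lin j) *m M"
  define G where "G i = (\<Prod>j\<in>{1..n - 1} - {i}. lin j) *m M" for i
  define H where "H = (mat (\<Prod>j\<in>{1..n - 1}. lin j) :: ('a, 'm) mat_poly)"
  define R where "R = F + ((\<Sum>i\<in>{1..n - 1}. mp_const (V i) ** G i) + mp_const (V n) ** H)"
  have bn: "b n = lin n" and bj: "j \<in> {1..n - 1} \<Longrightarrow> b j = lin j" for j
    using b n by (auto simp: lin_def)
  have prod_b: "(\<Prod>j\<in>J. b j) = (\<Prod>j\<in>J. lin j)" if "J \<subseteq> {1..n - 1}" for J
    using that bj by (intro prod.cong) auto
  have split: "{1..n} = insert n {1..n - 1}" and nn: "n \<notin> {1..n - 1}" using n by auto
  have all: "mat_prod_list (map (B_mp n b A s) [1..<Suc n]) = F"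
    unfolding mat_prod_list_B_mp_all[OF n] F_def M_def bn by (simp add: prod_b)
  have Ci: "C_mp n b A s i = G i" if "i \<in> {1..n - 1}" for i
    unfolding C_mp_before_last[OF that] G_def M_def bn by (simp add: prod_b)
  have Cn: "C_mp n b A s n = H"
    unfolding C_mp_last[OF n] H_def by (simp add: prod_b)
  have "(\<Sum>i\<in>{1..n}. mp_const (V i) ** C_mp n b A s i) =
      mp_const (V n) ** H + (\<Sum>i\<in>{1..n - 1}. mp_const (V i) ** G i)"
    unfolding split using nn by (simp add: Cn Ci)
  moreover have "mp_degree_less (mp_const (V i)) (degree (b i))" if "i \<in> {1..n}" for i
  proof -
    have "mp_degree_less (mp_const (V i)) 1"
      by (simp add: mp_degree_less_def vec_eq_iff coeff_pCons split: nat.split)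
    then show ?thesis using b that by simp
  qed
  ultimately have dec: "mp_decomposition P n n b s (\<lambda>i. mp_const (V i)) \<longleftrightarrow> P = R"
    unfolding mp_decomposition_def R_def A_def[symmetric] all by (simp add: add.commute)

  have deg_lin: "degree (\<Prod>j\<in>J. lin j) = card J" for J
    unfolding lin_def by (rule degree_prod_monic_linear)
  have prod_lin: "(\<Prod>j\<in>{1..n - 1}. lin j) * lin n = (\<Prod>j\<in>{1..n}. lin j)"
    unfolding split using nn by (simp add: mult.commute)
  have "lead_coeff (\<Prod>j\<in>{1..n}. lin j) = 1"
    by (simp add: lead_coeff_prod lin_def)
  then have top: "coeff (\<Prod>j\<in>{1..n}. lin j) n = 1" by (simp add: deg_lin)
  have "mp_degree_less (P - F) n"
    unfolding mp_degree_less_def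
  proof (intro allI impI)
    fix k assume k: "n \<le> k"
    have F: "mp_coeff F k = coeff (\<Prod>j\<in>{1..n}. lin j) k *m A"
      using k n unfolding F_def M_def mp_coeff_scaled_last_factor prod_lin
      by (simp add: coeff_eq_0 deg_lin)
    have "mp_coeff P k = mp_coeff F k"
    proof (cases "k = n")
      case True
      then show ?thesis using F top by (simp add: A_def)
    next
      case False
      then have "mp_coeff P k = 0" using k deg by (simp add: mp_has_degree_def)
      moreover have "coeff (\<Prod>j\<in>{1..n}. lin j) k = 0"
        using False k by (intro coeff_eq_0) (simp add: deg_lin)
      ultimately show ?thesis by (simp add: F vec_eq_iff)
    qed
    then show "mp_coeff (P - F) k = 0" by (simp add: vec_eq_iff)
  qed
  moreover have "mp_degree_less (G i) n" if i: "i \<in> {1..n - 1}" for i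
    unfolding mp_degree_less_def
  proof (intro allI impI)
    fix k assume k: "n \<le> k"
    have c: "card ({1..n - 1} - {i}) < n - 1" using i by auto
    have "degree ((\<Prod>j\<in>{1..n - 1} - {i}. lin j) * lin n) \<le> card ({1..n - 1} - {i}) + 1"
      using degree_mult_le[of "\<Prod>j\<in>{1..n - 1} - {i}. lin j" "lin n"]
      by (simp add: deg_lin lin_def[of n])
    then show "mp_coeff (G i) k = 0"
      using c k unfolding G_def M_def mp_coeff_scaled_last_factor
      by (simp add: coeff_eq_0 deg_lin vec_eq_iff mat_nth)
  qed
  moreover have "mp_degree_less H n"
    unfolding H_def using n by (intro mp_degree_less_mat) (simp add: deg_lin)
  \<comment> \<open>The minus signs of \<open>P - R\<close> go into the constants, so that closure under sums suffices.\<close>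
  ultimately have "mp_degree_less
      ((P - F) + ((\<Sum>i\<in>{1..n - 1}. mp_const (- V i) ** G i) + mp_const (- V n) ** H)) n"
    by (intro mp_degree_less_add mp_degree_less_sum mp_degree_less_const_mult)
  moreover have "mp_const (- V i) ** Q = - (mp_const (V i) ** Q)" for i and Q :: "('a, 'm) mat_poly"
    by (simp add: vec_eq_iff matrix_mult_nth sum_negf flip: minus_pCons)
  ultimately have deg_diff: "mp_degree_less (P - R) n"
    unfolding R_def by (simp add: sum_negf algebra_simps)
  have "P = R \<longleftrightarrow> (\<forall>i\<in>{1..n}. mp_eval P (\<beta> i) = mp_eval R (\<beta> i))"
    using mp_eqI_nodes[OF deg_diff, of "\<beta> ` {1..n}"] n inj by (auto simp: card_image)
  also have "\<dots> \<longleftrightarrow> (\<forall>i\<in>{1..n - 1}. mp_eval P (\<beta> i) = mp_eval R (\<beta> i)) \<and>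
      mp_eval P (\<beta> n) = mp_eval R (\<beta> n)"
    unfolding split by blast
  finally have nodes: "P = R \<longleftrightarrow> \<dots>" .

  have lin_eval: "poly (\<Prod>j\<in>J. lin j) x = (\<Prod>j\<in>J. x - \<beta> j)" for J x
    by (simp add: poly_prod lin_def)
  have M_eval: "mp_eval M x = (x - \<beta> n) *m A + mat s" for x
    unfolding M_def mp_eval_simps by (simp add: lin_def)
  have R_eval: "mp_eval R x = (\<Prod>j\<in>{1..n - 1}. x - \<beta> j) *m ((x - \<beta> n) *m A + mat s) +
      ((\<Sum>i\<in>{1..n - 1}. (\<Prod>j\<in>{1..n - 1} - {i}. x - \<beta> j) *m (V i ** ((x - \<beta> n) *m A + mat s))) +
       (\<Prod>j\<in>{1..n - 1}. x - \<beta> j) *m V n)" for x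
    unfolding R_def F_def G_def H_def mp_eval_simps M_eval lin_eval matrix_mult_scale
      matrix_mult_mat ..
  have zero_scale: "0 *m X = 0" for X :: "'a^'m^'m" by (simp add: vec_eq_iff)
  have "mp_eval R (\<beta> i) =
      (\<Prod>j\<in>{1..n - 1} - {i}. \<beta> i - \<beta> j) *m (V i ** ((\<beta> i - \<beta> n) *m A + mat s))"
    if i: "i \<in> {1..n - 1}" for i
  proof -
    have z: "(\<Prod>j\<in>J. \<beta> i - \<beta> j) = 0" if "i \<in> J" "finite J" for J
      using that by auto
    have "(\<Sum>k\<in>{1..n - 1}. (\<Prod>j\<in>{1..n - 1} - {k}. \<beta> i - \<beta> j) *m
          (V k ** ((\<beta> i - \<beta> n) *m A + mat s))) =
        (\<Prod>j\<in>{1..n - 1} - {i}. \<beta> i - \<beta> j) *m (V i ** ((\<beta> i - \<beta> n) *m A + mat s)) +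
        (\<Sum>k\<in>{1..n - 1} - {i}. (\<Prod>j\<in>{1..n - 1} - {k}. \<beta> i - \<beta> j) *m
          (V k ** ((\<beta> i - \<beta> n) *m A + mat s)))"
      using i by (intro sum.remove) auto
    also have "(\<Sum>k\<in>{1..n - 1} - {i}. (\<Prod>j\<in>{1..n - 1} - {k}. \<beta> i - \<beta> j) *m
          (V k ** ((\<beta> i - \<beta> n) *m A + mat s))) = 0"
    proof (rule sum.neutral, rule ballI)
      fix k assume "k \<in> {1..n - 1} - {i}"
      then have "(\<Prod>j\<in>{1..n - 1} - {k}. \<beta> i - \<beta> j) = 0" using i by (intro z) auto
      then show "(\<Prod>j\<in>{1..n - 1} - {k}. \<beta> i - \<beta> j) *m
          (V k ** ((\<beta> i - \<beta> n) *m A + mat s)) = 0"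
        by (simp only: zero_scale)
    qed
    finally show ?thesis
      unfolding R_eval z[OF i finite_atLeastAtMost] by (simp only: zero_scale add_0_left add_0_right)
  qed
  moreover have "mp_eval R (\<beta> n) = (\<Prod>j\<in>{1..n - 1}. \<beta> n - \<beta> j) *m (mat s + V n) +
       (\<Sum>i\<in>{1..n - 1}. (s * (\<Prod>j\<in>{1..n - 1} - {i}. \<beta> n - \<beta> j)) *m V i)"
    unfolding R_eval
    by (simp add: zero_scale matrix_mult_mat scale_scale scale_add mult.commute add_ac)
  ultimately show ?thesis unfolding dec nodes by simp
qed

section \<open>Solving the equations at the nodes\<close>

text \<open>A nonzero kernel vector of \<open>c A + s I\<close> is an eigenvector of \<open>A\<close> for \<open>-s/c\<close>, and at this eigenvalue
  \<open>l * c + s\<close> is zero.\<close>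

lemma invertible_scale_add_mat:
  fixes A :: "'a::field^'m::finite^'m"
  assumes c: "c \<noteq> 0" and no_eig: "\<And>l. mat_eigenvalue A l \<Longrightarrow> l * c + s \<noteq> 0"
  shows "invertible (c *m A + mat s)"
proof -
  have "v = 0" if v: "(c *m A + mat s) *v v = 0" for v
  proof (rule ccontr)
    assume "v \<noteq> 0"
    have "mat s *v v = s *s v"
      by (simp add: vec_eq_iff matrix_vector_mult_def mat_nth if_distrib if_distribR cong: if_cong)
    moreover have "(c *m A) *v v = c *s (A *v v)"
      by (simp add: vec_eq_iff matrix_vector_mult_def sum_distrib_left mult.assoc)
    ultimately have 0: "c *s (A *v v) + s *s v = 0"
      using v by (simp add: matrix_vector_mult_add_rdistrib)
    have "A *v v = (- s / c) *s v"
      unfolding vec_eq_iff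
    proof
      fix i
      have "c * (A *v v) $ i + s * v $ i = 0"
        using 0 by (simp add: vec_eq_iff)
      then show "(A *v v) $ i = ((- s / c) *s v) $ i"
        using c by (simp add: field_simps eq_neg_iff_add_eq_0)
    qed
    with \<open>v \<noteq> 0\<close> have "mat_eigenvalue A (- s / c)" by (auto simp: mat_eigenvalue_def)
    from no_eig[OF this] c show False by simp
  qed
  then show ?thesis
    by (simp add: invertible_left_inverse matrix_left_invertible_ker)
qed

lemma matrix_inv_cancel:
  assumes "invertible M"
  shows "M ** matrix_inv M = mat 1" "matrix_inv M ** M = mat 1"
  using someI_ex[OF assms[unfolded invertible_def]] by (simp_all add: matrix_inv_def)

lemma eq_scaled_mult_iff:
  fixes M :: "'a::field^'m::finite^'m"
  assumes M: "invertible M" and c: "c \<noteq> 0"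
  shows "E = c *m (X ** M) \<longleftrightarrow> X = ((1 / c) *m E) ** matrix_inv M"
proof
  assume "E = c *m (X ** M)"
  then have "(1 / c) *m E = X ** M" using c by (simp add: scale_scale)
  then show "X = ((1 / c) *m E) ** matrix_inv M"
    by (simp add: matrix_mul_assoc[symmetric] matrix_inv_cancel[OF M])
next
  assume "X = ((1 / c) *m E) ** matrix_inv M"
  then have "X ** M = (1 / c) *m E"
    by (simp add: matrix_mul_assoc[symmetric] matrix_inv_cancel[OF M])
  then show "E = c *m (X ** M)" using c by (simp add: scale_scale)
qed

text \<open>Omitting the factor with index \<open>i\<close> divides the product by \<open>d i\<close>. So the full product is a common
  factor of the whole right-hand side and can be divided out.\<close>

lemma last_node_equation_iff:
  fixes E :: "'a::field^'m::finite^'m"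
  assumes J: "finite J" and d: "\<forall>j\<in>J. d j \<noteq> 0"
  shows "E = (\<Prod>j\<in>J. d j) *m (mat s + X) + (\<Sum>i\<in>J. (s * (\<Prod>j\<in>J - {i}. d j)) *m V i) \<longleftrightarrow>
    X = (1 / (\<Prod>j\<in>J. d j)) *m E - mat s - s *m (\<Sum>j\<in>J. (1 / d j) *m V j)"
proof -
  define p where "p = (\<Prod>j\<in>J. d j)"
  define S where "S = s *m (\<Sum>j\<in>J. (1 / d j) *m V j)"
  have p: "p \<noteq> 0" using J d by (simp add: p_def)
  have "(\<Prod>j\<in>J - {i}. d j) = p / d i" if "i \<in> J" for i
    unfolding p_def using J d that by (simp add: prod.remove[of J i])
  then have "(\<Sum>i\<in>J. (s * (\<Prod>j\<in>J - {i}. d j)) *m V i) = (\<Sum>i\<in>J. p *m (s *m ((1 / d i) *m V i)))"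
    by (intro sum.cong) (simp_all add: scale_scale mult.commute)
  then have "(\<Sum>i\<in>J. (s * (\<Prod>j\<in>J - {i}. d j)) *m V i) = p *m S"
    by (simp add: S_def scale_sum)
  moreover have "E = p *m (mat s + X) + p *m S \<longleftrightarrow> X = (1 / p) *m E - mat s - S"
    using p by (auto simp: vec_eq_iff field_simps)
  ultimately show ?thesis by (simp add: p_def S_def)
qed

section \<open>The explicit coefficients\<close>

theorem corollary4p5:
  fixes P :: "('a::alg_closed_field, 'm::finite) mat_poly"
    and n q :: nat
    and b :: "nat \<Rightarrow> 'a poly"
    and s :: 'a
    and \<beta> :: "nat \<Rightarrow> 'a"
  assumes regular: "mp_regular P"
    and deg_P: "mp_has_degree P n"
    and q_pos: "1 \<le> q"
    and monic: "\<And>i. i \<in> {1..q} \<Longrightarrow> lead_coeff (b i) = 1"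
    and deg_b: "\<And>i. i \<in> {1..q} \<Longrightarrow> 1 \<le> degree (b i)"
    and coprime: "\<And>i j. i \<in> {1..q} \<Longrightarrow> j \<in> {1..q} \<Longrightarrow> i \<noteq> j \<Longrightarrow> coprime (b i) (b j)"
    and sum_deg: "(\<Sum>i\<in>{1..q}. degree (b i)) = n"
    and s_cond: "\<And>l i \<xi>. mat_eigenvalue (mp_coeff P n) l \<Longrightarrow> i \<in> {1..q - 1} \<Longrightarrow> poly (b i) \<xi> = 0
                   \<Longrightarrow> l * poly (b q) \<xi> + s \<noteq> 0"
    and linear: "\<And>i. i \<in> {1..q} \<Longrightarrow> b i = [:- \<beta> i, 1:]"
  shows "q = n \<and>
    (\<exists>V :: nat \<Rightarrow> 'a^'m^'m.
      mp_decomposition P n q b s (\<lambda>i. mp_const (V i)) \<and>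
      (\<forall>W. mp_decomposition P n q b s W \<longrightarrow> (\<forall>i\<in>{1..q}. W i = mp_const (V i))) \<and>
      (\<forall>i\<in>{1..n - 1}.
         invertible ((\<beta> i - \<beta> n) *m mp_coeff P n + mat s) \<and>
         V i = ((1 / (\<Prod>j\<in>{1..n - 1} - {i}. \<beta> i - \<beta> j)) *m mp_eval P (\<beta> i))
                 ** matrix_inv ((\<beta> i - \<beta> n) *m mp_coeff P n + mat s)) \<and>
      V n = (1 / (\<Prod>j\<in>{1..n - 1}. \<beta> n - \<beta> j)) *m mp_eval P (\<beta> n) - mat s
              - s *m (\<Sum>j\<in>{1..n - 1}. (1 / (\<beta> n - \<beta> j)) *m V j) \<and>
      (mp_coeff P n = mat 1 \<and> s = 0 \<longrightarrow>
        (\<forall>i\<in>{1..n}. V i = (1 / (\<Prod>j\<in>{1..n} - {i}. \<beta> i - \<beta> j)) *m mp_eval P (\<beta> i))))"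
proof -
  have n: "q = n"
    using sum_deg linear by simp
  note q_pos = q_pos[unfolded n] and coprime = coprime[unfolded n] and linear = linear[unfolded n]
    and s_cond = s_cond[unfolded n]
  define A where "A = mp_coeff P n"
  define M where "M i = (\<beta> i - \<beta> n) *m A + mat s" for i
  define c where "c i = (\<Prod>j\<in>{1..n - 1} - {i}. \<beta> i - \<beta> j)" for i
  have neq: "\<beta> i \<noteq> \<beta> j" if "i \<in> {1..n}" "j \<in> {1..n}" "i \<noteq> j" for i j
    using coprime[OF that] linear that by (auto simp: is_unit_pCons_iff)
  then have inj: "inj_on \<beta> {1..n}" by (meson inj_onI)
  have c: "c i \<noteq> 0" if "i \<in> {1..n - 1}" for i
    using that neq by (auto simp: c_def)
  have M: "invertible (M i)" if i: "i \<in> {1..n - 1}" for i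
    unfolding M_def
  proof (rule invertible_scale_add_mat)
    have i': "i \<in> {1..n}" and n': "n \<in> {1..n}" and "i \<noteq> n" using i by auto
    then show "\<beta> i - \<beta> n \<noteq> 0" using neq by simp
    show "l * (\<beta> i - \<beta> n) + s \<noteq> 0" if "mat_eigenvalue A l" for l
      using s_cond[of l i "\<beta> i"] that i linear[OF i'] linear[OF n'] by (simp add: A_def)
  qed
  define V1 where "V1 i = ((1 / c i) *m mp_eval P (\<beta> i)) ** matrix_inv (M i)" for i
  \<comment> \<open>The formula for index \<open>n\<close> contains the other unknowns, so \<open>Vn\<close> is a function of the whole
    family; its value at \<open>n\<close> does not enter.\<close>
  define Vn where "Vn V = (1 / (\<Prod>j\<in>{1..n - 1}. \<beta> n - \<beta> j)) *m mp_eval P (\<beta> n) - mat s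
              - s *m (\<Sum>j\<in>{1..n - 1}. (1 / (\<beta> n - \<beta> j)) *m V j)" for V :: "nat \<Rightarrow> 'a^'m^'m"
  have dec_iff: "mp_decomposition P n n b s (\<lambda>i. mp_const (V i)) \<longleftrightarrow>
      (\<forall>i\<in>{1..n - 1}. V i = V1 i) \<and> V n = Vn V" for V
  proof -
    have lin: "\<forall>i\<in>{1..n}. b i = [:- \<beta> i, 1:]" using linear by blast
    have "\<beta> n - \<beta> j \<noteq> 0" if "j \<in> {1..n - 1}" for j
      using that neq[of j n] by force
    then have ne: "\<forall>j\<in>{1..n - 1}. \<beta> n - \<beta> j \<noteq> 0" by blast
    have "(\<forall>i\<in>{1..n - 1}. mp_eval P (\<beta> i) = c i *m (V i ** M i)) \<longleftrightarrow>
        (\<forall>i\<in>{1..n - 1}. V i = V1 i)"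
      unfolding V1_def by (intro ball_cong refl eq_scaled_mult_iff M c)
    then show ?thesis
      unfolding mp_decomposition_const_iff_nodes[OF q_pos deg_P lin inj] Vn_def
        last_node_equation_iff[OF finite_atLeastAtMost ne] A_def[symmetric] M_def[symmetric]
        c_def[symmetric]
      by (rule arg_cong2[of _ _ _ _ "(\<and>)"]) (rule refl)
  qed
  define V where "V i = (if i = n then Vn V1 else V1 i)" for i
  have Vi: "V i = V1 i" if "i \<in> {1..n - 1}" for i using that by (auto simp: V_def)
  have Vn_cong: "Vn U = Vn V1" if "\<forall>i\<in>{1..n - 1}. U i = V1 i" for U
    unfolding Vn_def using that by (metis (no_types, lifting) sum.cong)
  have Vn: "V n = Vn V" using Vn_cong[of V] Vi by (simp add: V_def)
  have dec: "mp_decomposition P n n b s (\<lambda>i. mp_const (V i))"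
    unfolding dec_iff using Vi Vn by blast
  have unique: "W i = mp_const (V i)" if W: "mp_decomposition P n n b s W" and i: "i \<in> {1..n}" for W i
  proof -
    define U where "U i = mp_coeff (W i) 0" for i
    have WU: "W i = mp_const (U i)" if "i \<in> {1..n}" for i
    proof -
      have "mp_degree_less (W i) (degree (b i))"
        using W that unfolding mp_decomposition_def by blast
      then show ?thesis
        using linear[OF that] by (simp add: U_def mp_degree_less_one_imp_const)
    qed
    have "(\<Sum>i\<in>{1..n}. mp_const (U i) ** C_mp n b (mp_coeff P n) s i) =
        (\<Sum>i\<in>{1..n}. W i ** C_mp n b (mp_coeff P n) s i)"
      by (intro sum.cong) (simp_all only: WU)
    moreover have "\<forall>i\<in>{1..n}. mp_degree_less (mp_const (U i)) (degree (b i))"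
      using W unfolding mp_decomposition_def by (metis WU)
    ultimately have "mp_decomposition P n n b s (\<lambda>i. mp_const (U i))"
      using W unfolding mp_decomposition_def by (simp only:)
    then have U: "\<forall>i\<in>{1..n - 1}. U i = V1 i" "U n = Vn U" by (simp_all add: dec_iff)
    then have "U i = V i" using i Vn_cong[OF U(1)] by (auto simp: V_def)
    then show ?thesis using WU[OF i] by simp
  qed
  have monic_case: "V i = (1 / (\<Prod>j\<in>{1..n} - {i}. \<beta> i - \<beta> j)) *m mp_eval P (\<beta> i)"
    if "A = mat 1" "s = 0" and i: "i \<in> {1..n}" for i
  proof (cases "i = n")
    case True
    have "{1..n} - {n} = {1..n - 1}" by auto
    then show ?thesis using True Vn \<open>s = 0\<close>
      by (simp add: Vn_def vec_eq_iff mat_nth)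
  next
    case False
    then have i1: "i \<in> {1..n - 1}" using i by auto
    define d where "d = \<beta> i - \<beta> n"
    \<comment> \<open>Now \<open>B\<^sub>n\<close> is scalar at \<open>\<beta> i\<close> too, and its value is the missing factor of the product.\<close>
    have Md: "M i = mat d" using that by (simp add: M_def scale_mat d_def vec_eq_iff mat_nth)
    have ins: "{1..n} - {i} = insert n ({1..n - 1} - {i})" using i False by auto
    have "n \<notin> {1..n - 1} - {i}" using q_pos by auto
    then have prod: "(\<Prod>j\<in>{1..n} - {i}. \<beta> i - \<beta> j) = c i * d"
      unfolding ins c_def d_def by (subst prod.insert) (simp_all add: mult.commute)
    have d: "d \<noteq> 0" using neq[of i n] i False by (auto simp: d_def)
    have "mp_eval P (\<beta> i) = c i *m (V i ** M i)"
      using eq_scaled_mult_iff[OF M[OF i1] c[OF i1]] Vi[OF i1] by (simp add: V1_def)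
    then have "mp_eval P (\<beta> i) = (c i * d) *m V i"
      by (simp add: Md matrix_mult_mat scale_scale)
    then show ?thesis unfolding prod using c[OF i1] d by (simp add: scale_scale)
  qed
  show ?thesis
    unfolding n using dec unique M Vi Vn monic_case
    by (intro conjI refl exI[of _ V])
      (auto simp: V1_def Vn_def M_def c_def A_def)
qed

end
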